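(* Let $(x,s)\in\mathcal{C}$ be a feasible first-stage decision, let $\xi\in\mathbb{Z}_{\ge 0}^{|\mathcal{A}|}$, let $\hat i\in\mathcal{I}$, and assume $P_{ijl}\ge 0$ for all $(i,j)\in\mathcal{A}$, $l\in\mathcal{L}$. Let $\hat r=(\hat r_{jl})_{j\in\mathcal{J}_{\hat i},l\in\mathcal{L}}$ be an optimal solution of the problem $Q^{\hat i}(x,s,\xi)$: $$\max \sum_{j\in\mathcal{J}_{\hat i}}\sum_{l\in\mathcal{L}}P_{\hat ijl}r_{jl}\quad\text{s.t.}\quad r_{jl}\le \xi_{\hat ij}x_{\zeta(\hat i),\zeta(j),l}\ \ \forall j\in\mathcal{J}_{\hat i},\ l\in\mathcal{L};\qquad \sum_{(j,l)\in\mathcal{J}_{\hat i}\times\mathcal{L}}r_{jl}\le\sum_{v\in\mathcal{V}}s_{v\hat i};\qquad r_{jl}\in\mathbb{Z}_{\ge 0}\ \ \forall j\in\mathcal{J}_{\hat i},\ l\in\mathcal{L}.$$ Then an optimal solution $\big((\hat\alpha_{jl})_{j\in\mathcal{J}_{\hat i},l\in\mathcal{L}},\hat\beta\big)$ of the dual (of the linear programming relaxation) problem $$\min \sum_{(j,l)\in\mathcal{J}_{\hat i}\times\mathcal{L}}\xi_{\hat ij}x_{\zeta(\hat i),\zeta(j),l}\,\alpha_{jl}+\sum_{v\in\mathcal{V}}s_{v\hat i}\,\beta\quad\text{s.t.}\quad\alpha_{jl}+\beta\ge P_{\hat ijl},\ \ \alpha_{jl}\ge 0\ \ \forall(j,l)\in\mathcal{J}_{\hat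 i}\times\mathcal{L};\qquad\beta\ge 0$$ is obtained as follows. (Case 1) If $\sum_{v\in\mathcal{V}}s_{v\hat i}\ge\sum_{(j,l)\in\mathcal{J}_{\hat i}\times\mathcal{L}}\xi_{\hat ij}x_{\zeta(\hat i),\zeta(j),l}$, then $$\hat\beta=0,\qquad\hat\alpha_{jl}=P_{\hat ijl}\quad\forall(j,l)\in\mathcal{J}_{\hat i}\times\mathcal{L}.$$ (Case 2) Otherwise, $$\hat\beta=\max_{(j,l)\in\mathcal{J}_{\hat i}\times\mathcal{L}}\left\{P_{\hat ijl}\ :\ \hat r_{jl}<\xi_{\hat ij}x_{\zeta(\hat i),\zeta(j),l},\ \xi_{\hat ij}x_{\zeta(\hat i),\zeta(j),l}>0\right\},\qquad\hat\alpha_{jl}=\max\{0,P_{\hat ijl}-\hat\beta\}\quad\forall(j,l)\in\mathcal{J}_{\hat i}\times\mathcal{L}.$$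
   Context: $\mathcal{I}$ (stations), $\mathcal{Z}$ (zones), $\mathcal{L}$ (price levels), $\mathcal{V}$ (vehicles) are finite nonempty sets. $\mathcal{A}=\{(i,j): i,j\in\mathcal{I},\ i\ne j\}$. The stations are partitioned into zones, and $\zeta:\mathcal{I}\to\mathcal{Z}$ maps a station to its zone. $\mathcal{J}_i=\{j\in\mathcal{I}:(i,j)\in\mathcal{A}\}$. $P_{ijl}$ is the rental price from station $i$ to station $j$ at price level $l$. $\mathcal{C}$ is the set of pairs $(x,s)$ with $x=(x_{z_1,z_2,l})\in\{0,1\}^{|\mathcal{Z}|\times|\mathcal{Z}|\times|\mathcal{L}|}$ and $s=(s_{vi})\in\{0,1\}^{|\mathcal{V}|\times|\mathcal{I}|}$ such that $\sum_{l\in\mathcal{L}}x_{z_1,z_2,l}=1$ for all $z_1,z_2\in\mathcal{Z}$ and $\sum_{i\in\mathcal{I}}s_{vi}=1$ for all $v\in\mathcal{V}$. *)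

theory Defs
  imports Complex_Main
begin

text \<open>
  Stations, zones, price levels and vehicles are the types \<open>'i\<close>, \<open>'z\<close>, \<open>'l\<close>, \<open>'v\<close> of class
  \<open>finite\<close>, so they are finite and nonempty. The set \<open>\<Z>\<^sub>\<ge>\<^sub>0\<close> is \<open>nat\<close>.
  Families indexed by arcs or by destinations are total functions; their values off the
  arcs (i.e. on the diagonal) are never used.
\<close>

definition arcs :: "('i \<times> 'i) set" where
  "arcs = {(i, j). i \<noteq> j}"

definition dests :: "'i \<Rightarrow> 'i set" where
  "dests i = {j. (i, j) \<in> arcs}"

definition first_stage ::
  "(('z::finite \<Rightarrow> 'z \<Rightarrow> 'l::finite \<Rightarrow> nat) \<times> ('v::finite \<Rightarrow> 'i::finite \<Rightarrow> nat)) set" where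
  "first_stage = {(x, s).
     (\<forall>z1 z2 l. x z1 z2 l \<in> {0, 1}) \<and> (\<forall>v i. s v i \<in> {0, 1}) \<and>
     (\<forall>z1 z2. (\<Sum>l\<in>UNIV. x z1 z2 l) = 1) \<and> (\<forall>v. (\<Sum>i\<in>UNIV. s v i) = 1)}"

definition demand ::
  "('i \<Rightarrow> 'z) \<Rightarrow> ('z \<Rightarrow> 'z \<Rightarrow> 'l \<Rightarrow> nat) \<Rightarrow> ('i \<times> 'i \<Rightarrow> nat) \<Rightarrow> 'i \<Rightarrow> 'i \<Rightarrow> 'l \<Rightarrow> nat" where
  "demand \<zeta> x \<xi> i j l = \<xi> (i, j) * x (\<zeta> i) (\<zeta> j) l"

definition vehicles_at :: "('v::finite \<Rightarrow> 'i \<Rightarrow> nat) \<Rightarrow> 'i \<Rightarrow> nat" where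
  "vehicles_at s i = (\<Sum>v\<in>UNIV. s v i)"

text \<open>The second-stage problem \<open>Q\<^sup>i(x, s, \<xi>)\<close> of station \<open>i\<close>.\<close>

definition rental_feasible ::
  "('i::finite \<Rightarrow> 'z) \<Rightarrow> ('z \<Rightarrow> 'z \<Rightarrow> 'l::finite \<Rightarrow> nat) \<Rightarrow> ('v::finite \<Rightarrow> 'i \<Rightarrow> nat) \<Rightarrow>
   ('i \<times> 'i \<Rightarrow> nat) \<Rightarrow> 'i \<Rightarrow> ('i \<Rightarrow> 'l \<Rightarrow> nat) \<Rightarrow> bool" where
  "rental_feasible \<zeta> x s \<xi> i r \<longleftrightarrow>
     (\<forall>j\<in>dests i. \<forall>l. r j l \<le> demand \<zeta> x \<xi> i j l) \<and>
     (\<Sum>(j, l)\<in>dests i \<times> UNIV. r j l) \<le> vehicles_at s i"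

definition rental_revenue ::
  "('i::finite \<Rightarrow> 'i \<Rightarrow> 'l::finite \<Rightarrow> real) \<Rightarrow> 'i \<Rightarrow> ('i \<Rightarrow> 'l \<Rightarrow> nat) \<Rightarrow> real" where
  "rental_revenue P i r = (\<Sum>j\<in>dests i. \<Sum>l\<in>UNIV. P i j l * real (r j l))"

definition rental_optimal ::
  "('i::finite \<Rightarrow> 'z) \<Rightarrow> ('i \<Rightarrow> 'i \<Rightarrow> 'l::finite \<Rightarrow> real) \<Rightarrow> ('z \<Rightarrow> 'z \<Rightarrow> 'l \<Rightarrow> nat) \<Rightarrow>
   ('v::finite \<Rightarrow> 'i \<Rightarrow> nat) \<Rightarrow> ('i \<times> 'i \<Rightarrow> nat) \<Rightarrow> 'i \<Rightarrow> ('i \<Rightarrow> 'l \<Rightarrow> nat) \<Rightarrow> bool" where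
  "rental_optimal \<zeta> P x s \<xi> i r \<longleftrightarrow>
     is_arg_max (rental_revenue P i) (rental_feasible \<zeta> x s \<xi> i) r"

text \<open>
  The linear programming dual of the continuous relaxation of \<open>Q\<^sup>i(x, s, \<xi>)\<close>: \<open>\<alpha> j l\<close> is the
  multiplier of the demand bound on \<open>r j l\<close>, and \<open>\<beta>\<close> that of the supply bound.
\<close>

definition dual_feasible ::
  "('i::finite \<Rightarrow> 'i \<Rightarrow> 'l::finite \<Rightarrow> real) \<Rightarrow> 'i \<Rightarrow> ('i \<Rightarrow> 'l \<Rightarrow> real) \<times> real \<Rightarrow> bool" where
  "dual_feasible P i = (\<lambda>(\<alpha>, \<beta>).
     (\<forall>j\<in>dests i. \<forall>l. \<alpha> j l + \<beta> \<ge> P i j l \<and> \<alpha> j l \<ge> 0) \<and> \<beta> \<ge> 0)"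

definition dual_cost ::
  "('i::finite \<Rightarrow> 'z) \<Rightarrow> ('z \<Rightarrow> 'z \<Rightarrow> 'l::finite \<Rightarrow> nat) \<Rightarrow> ('v::finite \<Rightarrow> 'i \<Rightarrow> nat) \<Rightarrow>
   ('i \<times> 'i \<Rightarrow> nat) \<Rightarrow> 'i \<Rightarrow> ('i \<Rightarrow> 'l \<Rightarrow> real) \<times> real \<Rightarrow> real" where
  "dual_cost \<zeta> x s \<xi> i = (\<lambda>(\<alpha>, \<beta>).
     (\<Sum>(j, l)\<in>dests i \<times> UNIV. real (demand \<zeta> x \<xi> i j l) * \<alpha> j l) + real (vehicles_at s i) * \<beta>)"

definition dual_optimal ::
  "('i::finite \<Rightarrow> 'z) \<Rightarrow> ('i \<Rightarrow> 'i \<Rightarrow> 'l::finite \<Rightarrow> real) \<Rightarrow> ('z \<Rightarrow> 'z \<Rightarrow> 'l \<Rightarrow> nat) \<Rightarrow>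
   ('v::finite \<Rightarrow> 'i \<Rightarrow> nat) \<Rightarrow> ('i \<times> 'i \<Rightarrow> nat) \<Rightarrow> 'i \<Rightarrow>
   ('i \<Rightarrow> 'l \<Rightarrow> real) \<times> real \<Rightarrow> bool" where
  "dual_optimal \<zeta> P x s \<xi> i = is_arg_min (dual_cost \<zeta> x s \<xi> i) (dual_feasible P i)"

text \<open>
  The maximum is only meaningful when some demand is not fully served; this is the case for
  every feasible \<open>r\<close> as soon as the total demand exceeds the supply.
\<close>

definition marginal_price ::
  "('i::finite \<Rightarrow> 'z) \<Rightarrow> ('i \<Rightarrow> 'i \<Rightarrow> 'l::finite \<Rightarrow> real) \<Rightarrow> ('z \<Rightarrow> 'z \<Rightarrow> 'l \<Rightarrow> nat) \<Rightarrow>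
   ('i \<times> 'i \<Rightarrow> nat) \<Rightarrow> 'i \<Rightarrow> ('i \<Rightarrow> 'l \<Rightarrow> nat) \<Rightarrow> real" where
  "marginal_price \<zeta> P x \<xi> i r =
     Max {P i j l | j l. j \<in> dests i \<and> r j l < demand \<zeta> x \<xi> i j l \<and> demand \<zeta> x \<xi> i j l > 0}"

end

theory Submission
  imports Defs
begin

text \<open>
  For one station the rental problem is a knapsack with unit weights: the vehicles are
  distributed over the items \<open>(j, l)\<close>, each with a price and an integral demand bound. Weak
  duality bounds every revenue by every dual cost, so a dual solution is optimal as soon as
  complementary slackness links it to some feasible allocation
  (\<open>dual_optimal_if_complementary\<close>).

  When there are enough vehicles, this allocation serves the whole demand: the supply
  constraint then may have multiplier \<open>0\<close>, and each item is worth its price.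

  When vehicles are scarce, it is the given optimal allocation \<open>r\<close>, and its optimality is used
  against two modifications by one unit. If a vehicle is idle, renting it to an item with
  unserved demand gains nothing; prices being nonnegative, all items with unserved demand then
  have price \<open>0\<close>, and so has their maximum \<open>\<beta>\<close> (\<open>spare_capacity_imp_price_nonpos\<close>). Moving one
  vehicle from an item with \<open>r > 0\<close> to an item with unserved demand gains nothing either, so
  every item with \<open>r > 0\<close> has price at least \<open>\<beta>\<close> (\<open>exchange_imp_price_le\<close>). An item priced above
  \<open>\<beta>\<close> is fully served, because \<open>\<beta>\<close> is a maximum. These three facts are the slackness conditions
  for \<open>\<beta>\<close> together with \<open>max 0 (p - \<beta>)\<close>, the least multipliers that dual feasibility permits.
\<close>

section \<open>Integral allocations of a common resource\<close>

definition allocation :: "'k set \<Rightarrow> ('k \<Rightarrow> nat) \<Rightarrow> nat \<Rightarrow> ('k \<Rightarrow> nat) \<Rightarrow> bool" where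
  "allocation K d c r \<longleftrightarrow> (\<forall>k\<in>K. r k \<le> d k) \<and> sum r K \<le> c"

definition revenue :: "'k set \<Rightarrow> ('k \<Rightarrow> real) \<Rightarrow> ('k \<Rightarrow> nat) \<Rightarrow> real" where
  "revenue K p r = (\<Sum>k\<in>K. p k * real (r k))"

lemma allocation_weak_duality:
  assumes alloc: "allocation K d c r"
    and dual: "\<And>k. k \<in> K \<Longrightarrow> p k \<le> \<alpha> k + \<beta>" "\<And>k. k \<in> K \<Longrightarrow> 0 \<le> \<alpha> k" "0 \<le> \<beta>"
  shows "revenue K p r \<le> (\<Sum>k\<in>K. real (d k) * \<alpha> k) + real c * \<beta>"
proof -
  have "revenue K p r \<le> (\<Sum>k\<in>K. real (d k) * \<alpha> k + real (r k) * \<beta>)"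
    unfolding revenue_def
  proof (rule sum_mono)
    fix k assume k: "k \<in> K"
    have "p k * real (r k) \<le> (\<alpha> k + \<beta>) * real (r k)"
      using dual(1)[OF k] by (rule mult_right_mono) simp
    also have "\<dots> = real (r k) * \<alpha> k + real (r k) * \<beta>"
      by (simp add: algebra_simps)
    also have "\<dots> \<le> real (d k) * \<alpha> k + real (r k) * \<beta>"
      using alloc k dual(2)[OF k] by (simp add: allocation_def mult_right_mono)
    finally show "p k * real (r k) \<le> real (d k) * \<alpha> k + real (r k) * \<beta>" .
  qed
  also have "\<dots> = (\<Sum>k\<in>K. real (d k) * \<alpha> k) + real (sum r K) * \<beta>"
    by (simp add: sum.distrib sum_distrib_right)
  also have "\<dots> \<le> (\<Sum>k\<in>K. real (d k) * \<alpha> k) + real c * \<beta>"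
    using alloc dual(3)
    by (intro add_left_mono mult_right_mono) (simp_all add: allocation_def flip: of_nat_sum)
  finally show ?thesis .
qed

text \<open>
  Under complementary slackness none of the estimates in \<open>allocation_weak_duality\<close> loses anything.
\<close>

lemma allocation_complementary_slackness:
  assumes served: "\<And>k. k \<in> K \<Longrightarrow> 0 < r k \<Longrightarrow> \<alpha> k + \<beta> = p k"
    and unserved: "\<And>k. k \<in> K \<Longrightarrow> r k \<noteq> d k \<Longrightarrow> \<alpha> k = 0"
    and spare: "sum r K \<noteq> c \<Longrightarrow> \<beta> = 0"
  shows "revenue K p r = (\<Sum>k\<in>K. real (d k) * \<alpha> k) + real c * \<beta>"
proof -
  have "revenue K p r = (\<Sum>k\<in>K. real (d k) * \<alpha> k + real (r k) * \<beta>)"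
    unfolding revenue_def
  proof (rule sum.cong[OF refl])
    fix k assume k: "k \<in> K"
    have "p k * real (r k) = (\<alpha> k + \<beta>) * real (r k)"
      using served[OF k] by (cases "r k = 0") auto
    also have "\<dots> = real (d k) * \<alpha> k + real (r k) * \<beta>"
      using unserved[OF k] by (cases "r k = d k") (auto simp: algebra_simps)
    finally show "p k * real (r k) = real (d k) * \<alpha> k + real (r k) * \<beta>" .
  qed
  also have "\<dots> = (\<Sum>k\<in>K. real (d k) * \<alpha> k) + real (sum r K) * \<beta>"
    by (simp add: sum.distrib sum_distrib_right)
  also have "\<dots> = (\<Sum>k\<in>K. real (d k) * \<alpha> k) + real c * \<beta>"
    using spare by (cases "sum r K = c") (auto simp flip: of_nat_sum)
  finally show ?thesis .
qed

section \<open>Optimality against changes by one unit\<close>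

lemma revenue_fun_upd:
  assumes "finite K" "k \<in> K"
  shows "revenue K p (r(k := n)) = revenue K p r + p k * (real n - real (r k))"
proof -
  have "(\<Sum>m\<in>K - {k}. p m * real ((r(k := n)) m)) = (\<Sum>m\<in>K - {k}. p m * real (r m))"
    by (intro sum.cong) auto
  then show ?thesis
    using assms by (simp add: revenue_def sum.remove algebra_simps)
qed

lemma sum_fun_upd_nat:
  fixes r :: "'k \<Rightarrow> nat"
  assumes "finite K" "k \<in> K"
  shows "sum (r(k := n)) K + r k = sum r K + n"
proof -
  have "sum (r(k := n)) (K - {k}) = sum r (K - {k})"
    by (intro sum.cong) auto
  then show ?thesis
    using assms by (simp add: sum.remove)
qed

lemma spare_capacity_imp_price_nonpos:
  assumes "finite K" and alloc: "allocation K d c r"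
    and opt: "\<And>r'. allocation K d c r' \<Longrightarrow> revenue K p r' \<le> revenue K p r"
    and m: "m \<in> K" "r m < d m" and spare: "sum r K < c"
  shows "p m \<le> 0"
proof -
  have "allocation K d c (r(m := Suc (r m)))"
    using alloc m spare sum_fun_upd_nat[OF \<open>finite K\<close> m(1), of r "Suc (r m)"]
    by (auto simp: allocation_def)
  from opt[OF this] show ?thesis
    using revenue_fun_upd[OF \<open>finite K\<close> m(1)] by simp
qed

lemma exchange_imp_price_le:
  assumes "finite K" and alloc: "allocation K d c r"
    and opt: "\<And>r'. allocation K d c r' \<Longrightarrow> revenue K p r' \<le> revenue K p r"
    and m: "m \<in> K" "r m < d m" and k: "k \<in> K" "0 < r k"
  shows "p m \<le> p k"
proof (cases "k = m")
  case False
  define r' where "r' = r(k := r k - 1)"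
  have "allocation K d c (r'(m := Suc (r' m)))"
    using alloc m k False sum_fun_upd_nat[OF \<open>finite K\<close> m(1), of r' "Suc (r' m)"]
      sum_fun_upd_nat[OF \<open>finite K\<close> k(1), of r "r k - 1"]
    by (auto simp: allocation_def r'_def le_diff_conv)
  from opt[OF this] have "revenue K p r' + p m \<le> revenue K p r"
    using revenue_fun_upd[OF \<open>finite K\<close> m(1)] by simp
  then show ?thesis
    using revenue_fun_upd[OF \<open>finite K\<close> k(1), of p r "r k - 1"] k(2) by (simp add: r'_def of_nat_diff)
qed simp

section \<open>Dual solutions of the rental problem of one station\<close>

lemma rental_feasible_iff_allocation:
  "rental_feasible \<zeta> x s \<xi> i r \<longleftrightarrow>
     allocation (dests i \<times> UNIV) (case_prod (demand \<zeta> x \<xi> i)) (vehicles_at s i) (case_prod r)"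
  by (auto simp: rental_feasible_def allocation_def)

lemma rental_revenue_eq:
  "rental_revenue P i r = revenue (dests i \<times> UNIV) (case_prod (P i)) (case_prod r)"
  by (simp add: rental_revenue_def revenue_def sum.cartesian_product case_prod_unfold)

lemma dual_cost_eq:
  "dual_cost \<zeta> x s \<xi> i (\<alpha>, \<beta>) =
     (\<Sum>k\<in>dests i \<times> UNIV. real (case_prod (demand \<zeta> x \<xi> i) k) * case_prod \<alpha> k)
       + real (vehicles_at s i) * \<beta>"
  by (simp add: dual_cost_def case_prod_unfold)

lemma dual_optimal_if_complementary:
  assumes feasible: "dual_feasible P i (\<alpha>, \<beta>)"
    and rental: "rental_feasible \<zeta> x s \<xi> i r"
    and served: "\<And>j l. j \<in> dests i \<Longrightarrow> 0 < r j l \<Longrightarrow> \<alpha> j l + \<beta> = P i j l"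
    and unserved: "\<And>j l. j \<in> dests i \<Longrightarrow> r j l \<noteq> demand \<zeta> x \<xi> i j l \<Longrightarrow> \<alpha> j l = 0"
    and spare: "(\<Sum>(j, l)\<in>dests i \<times> UNIV. r j l) \<noteq> vehicles_at s i \<Longrightarrow> \<beta> = 0"
  shows "dual_optimal \<zeta> P x s \<xi> i (\<alpha>, \<beta>)"
proof -
  have cost: "rental_revenue P i r = dual_cost \<zeta> x s \<xi> i (\<alpha>, \<beta>)"
    unfolding rental_revenue_eq dual_cost_eq
    by (rule allocation_complementary_slackness) (use served unserved spare in auto)
  have "rental_revenue P i r \<le> dual_cost \<zeta> x s \<xi> i (\<alpha>', \<beta>')"
    if "dual_feasible P i (\<alpha>', \<beta>')" for \<alpha>' \<beta>'
    unfolding rental_revenue_eq dual_cost_eq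
    by (rule allocation_weak_duality)
      (use that rental in \<open>auto simp: dual_feasible_def rental_feasible_iff_allocation\<close>)
  then show ?thesis
    using feasible cost by (fastforce simp: dual_optimal_def is_arg_min_linorder)
qed

text \<open>
  With scarce supply some demand stays unserved, so the maximum that defines the marginal price
  is over a nonempty set and is attained.
\<close>

lemma marginal_price_attained:
  assumes rental: "rental_feasible \<zeta> x s \<xi> i r"
    and scarce: "vehicles_at s i < (\<Sum>(j, l)\<in>dests i \<times> UNIV. demand \<zeta> x \<xi> i j l)"
  obtains j l where "j \<in> dests i" "r j l < demand \<zeta> x \<xi> i j l"
    "marginal_price \<zeta> P x \<xi> i r = P i j l"
proof -
  let ?U = "{P i j l | j l. j \<in> dests i \<and> r j l < demand \<zeta> x \<xi> i j l \<and> demand \<zeta> x \<xi> i j l > 0}"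
  have "?U \<noteq> {}"
  proof
    assume "?U = {}"
    then have "demand \<zeta> x \<xi> i j l \<le> r j l" if "j \<in> dests i" for j l
      using that by (force simp: not_less[symmetric])
    then have "(\<Sum>(j, l)\<in>dests i \<times> UNIV. demand \<zeta> x \<xi> i j l) \<le> (\<Sum>(j, l)\<in>dests i \<times> UNIV. r j l)"
      by (intro sum_mono) auto
    with rental scarce show False
      by (simp add: rental_feasible_def)
  qed
  moreover have "finite ?U"
    by (rule finite_subset[of _ "(\<lambda>(j, l). P i j l) ` UNIV"]) auto
  ultimately have "marginal_price \<zeta> P x \<xi> i r \<in> ?U"
    unfolding marginal_price_def by (rule Max_in[rotated])
  then show thesis
    using that by auto
qed

lemma unserved_price_le_marginal_price:
  fixes P :: "'i::finite \<Rightarrow> 'i \<Rightarrow> 'l::finite \<Rightarrow> real"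
  assumes "j \<in> dests i" "r j l < demand \<zeta> x \<xi> i j l"
  shows "P i j l \<le> marginal_price \<zeta> P x \<xi> i r"
  unfolding marginal_price_def
proof (rule Max_ge)
  show "finite {P i j l | j l. j \<in> dests i \<and> r j l < demand \<zeta> x \<xi> i j l \<and> demand \<zeta> x \<xi> i j l > 0}"
    by (rule finite_subset[of _ "(\<lambda>(j, l). P i j l) ` UNIV"]) auto
qed (use assms in \<open>auto intro!: exI[of _ j] exI[of _ l]\<close>)

theorem proposition3p3:
  fixes \<zeta> :: "'i::finite \<Rightarrow> 'z::finite"
    and P :: "'i \<Rightarrow> 'i \<Rightarrow> 'l::finite \<Rightarrow> real"
    and x :: "'z \<Rightarrow> 'z \<Rightarrow> 'l \<Rightarrow> nat"
    and s :: "'v::finite \<Rightarrow> 'i \<Rightarrow> nat"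
    and \<xi> :: "'i \<times> 'i \<Rightarrow> nat"
    and i :: 'i
    and r :: "'i \<Rightarrow> 'l \<Rightarrow> nat"
  assumes "(x, s) \<in> first_stage"
    and "\<forall>(k, j)\<in>arcs. \<forall>l. P k j l \<ge> 0"
    and "rental_optimal \<zeta> P x s \<xi> i r"
  shows "(vehicles_at s i \<ge> (\<Sum>(j, l)\<in>dests i \<times> UNIV. demand \<zeta> x \<xi> i j l) \<longrightarrow>
            dual_optimal \<zeta> P x s \<xi> i (\<lambda>j l. P i j l, 0)) \<and>
         (\<not> vehicles_at s i \<ge> (\<Sum>(j, l)\<in>dests i \<times> UNIV. demand \<zeta> x \<xi> i j l) \<longrightarrow>
            (let \<beta> = marginal_price \<zeta> P x \<xi> i r
             in dual_optimal \<zeta> P x s \<xi> i (\<lambda>j l. max 0 (P i j l - \<beta>), \<beta>)))"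
proof -
  let ?K = "dests i \<times> (UNIV :: 'l set)"
  let ?d = "case_prod (demand \<zeta> x \<xi> i)" and ?c = "vehicles_at s i"
  have price_nonneg: "0 \<le> P i j l" if "j \<in> dests i" for j l
    using assms(2) that by (auto simp: dests_def)
  have rental: "rental_feasible \<zeta> x s \<xi> i r"
    using assms(3) by (simp add: rental_optimal_def is_arg_max_linorder)
  have alloc: "allocation ?K ?d ?c (case_prod r)"
    using rental by (simp add: rental_feasible_iff_allocation)
  have opt: "revenue ?K (case_prod (P i)) r' \<le> revenue ?K (case_prod (P i)) (case_prod r)"
    if "allocation ?K ?d ?c r'" for r'
  proof -
    have "rental_feasible \<zeta> x s \<xi> i (curry r')"
      using that by (simp add: rental_feasible_iff_allocation)
    then have "rental_revenue P i (curry r') \<le> rental_revenue P i r"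
      using assms(3) by (simp add: rental_optimal_def is_arg_max_linorder)
    then show ?thesis
      by (simp add: rental_revenue_eq)
  qed
  have ample: "dual_optimal \<zeta> P x s \<xi> i (\<lambda>j l. P i j l, 0)"
    if "(\<Sum>(j, l)\<in>?K. demand \<zeta> x \<xi> i j l) \<le> ?c"
    by (rule dual_optimal_if_complementary[where r = "demand \<zeta> x \<xi> i"])
      (use that price_nonneg in \<open>auto simp: dual_feasible_def rental_feasible_def\<close>)
  have scarce: "dual_optimal \<zeta> P x s \<xi> i (\<lambda>j l. max 0 (P i j l - \<beta>), \<beta>)"
    if less: "?c < (\<Sum>(j, l)\<in>?K. demand \<zeta> x \<xi> i j l)" and \<beta>: "\<beta> = marginal_price \<zeta> P x \<xi> i r"
    for \<beta>
  proof -
    obtain j0 l0 where j0: "j0 \<in> dests i" "r j0 l0 < demand \<zeta> x \<xi> i j0 l0" and \<beta>_eq: "\<beta> = P i j0 l0"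
      using marginal_price_attained[OF rental less] \<beta> by metis
    have served: "\<beta> \<le> P i j l" if "j \<in> dests i" "0 < r j l" for j l
      using exchange_imp_price_le[OF _ alloc opt, of "(j0, l0)" "(j, l)"] j0 that
      by (simp add: \<beta>_eq)
    have unserved: "P i j l \<le> \<beta>" if "j \<in> dests i" "r j l \<noteq> demand \<zeta> x \<xi> i j l" for j l
    proof -
      have "r j l < demand \<zeta> x \<xi> i j l"
        using rental that by (simp add: rental_feasible_def le_neq_implies_less)
      then show ?thesis
        unfolding \<beta> by (rule unserved_price_le_marginal_price[where P = P, OF that(1)])
    qed
    have spare: "\<beta> = 0" if "(\<Sum>(j, l)\<in>?K. r j l) \<noteq> ?c"
    proof -
      have "(\<Sum>(j, l)\<in>?K. r j l) < ?c"
        using rental that by (simp add: rental_feasible_def)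
      then have "\<beta> \<le> 0"
        using spare_capacity_imp_price_nonpos[OF _ alloc opt, of "(j0, l0)"] j0
        by (simp add: \<beta>_eq)
      then show ?thesis
        using price_nonneg[OF j0(1)] by (simp add: \<beta>_eq antisym)
    qed
    show ?thesis
    proof (rule dual_optimal_if_complementary[OF _ rental])
      show "dual_feasible P i (\<lambda>j l. max 0 (P i j l - \<beta>), \<beta>)"
        using price_nonneg[OF j0(1)] by (auto simp: dual_feasible_def \<beta>_eq)
    qed (use served unserved spare in \<open>force simp: max_def\<close>)+
  qed
  show ?thesis
    using ample scarce by (simp add: Let_def not_le)
qed

end
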